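(* Let $m$ be a nonnegative integer and $y\in(0,1)$. If $r\geq 2$ is an integer, then \[ \zeta^\star(m+2,\{1\}_{r-1})=\mathrm{Li}^\star_{\{1\}_{m+r+1}}\big(y,\{1\}_m,y^{-1},\{1\}_{r-1}\big)-\mathrm{Li}^\star_{\{1\}_{m+r+1}}\big(y,\{1\}_m,y^{-1},\{1\}_{r-2},y\big), \] and if $r=1$, then \[ \zeta^\star(m+2)=\mathrm{Li}^\star_{\{1\}_{m+2}}\big(y,\{1\}_m,y^{-1}\big)-\mathrm{Li}^\star_{\{1\}_{m+2}}\big(y,\{1\}_{m+1}\big). \]
   Context: For a composition $\mathbf{k}=(k_1,\ldots,k_d)$ of positive integers with $k_1\geq 2$, the multiple zeta star value is $\zeta^\star(\mathbf{k})=\sum_{n_1\geq n_2\geq\cdots\geq n_d\geq1}\frac{1}{n_1^{k_1}\cdots n_d^{k_d}}$. For a composition $\mathbf{k}=(k_1,\ldots,k_d)$ and complex numbers $x_1,\ldots,x_d$, the multiple polylogarithm star function is the series $\mathrm{Li}^\star_{\mathbf{k}}(x_1,\ldots,x_d)=\sum_{n_1\geq n_2\geq\cdots\geq n_d\geq1}\frac{x_1^{n_1}\cdots x_d^{n_d}}{n_1^{k_1}\cdots n_d^{k_d}}$. The notation $\{a\}_d$ means the entry $a$ repeated $d$ times (empty if $d=0$); e.g. $(\{1\}_{m+r+1})$ is the composition of $m+r+1$ ones, and $(y,\{1\}_m,y^{-1},\{1\}_{r-1})$ is the argument list $y$, then $m$ ones, then $y^{-1}$, then $r-1$ ones. *)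

theory Defs
  imports "HOL-Analysis.Analysis"
begin

definition star_indices :: "nat \<Rightarrow> nat list set" where
  "star_indices d = {ns. length ns = d \<and> sorted_wrt (\<ge>) ns \<and> (\<forall>n\<in>set ns. n \<ge> 1)}"

text \<open>
  The sums are unconditional; a family that is not unconditionally summable gets the
  library's default value \<open>0\<close>, so the values below are meaningful for (absolutely)
  convergent series only.
\<close>

definition zeta_star :: "nat list \<Rightarrow> real" where
  "zeta_star ks =
     (\<Sum>\<^sub>\<infinity>ns\<in>star_indices (length ks). \<Prod>i<length ks. 1 / real (ns ! i) ^ (ks ! i))"

text \<open>The two arguments of \<open>Li_star\<close> are meant to have the same length.\<close>

definition Li_star :: "nat list \<Rightarrow> complex list \<Rightarrow> complex" where
  "Li_star ks xs =
     (\<Sum>\<^sub>\<infinity>ns\<in>star_indices (length ks).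
        \<Prod>i<length ks. (xs ! i) ^ (ns ! i) / of_nat (ns ! i) ^ (ks ! i))"

end

theory Submission
  imports Defs
begin

text \<open>
  For every \<open>r \<ge> 1\<close> the difference of the two polylogarithms is the sum of
  \<open>y^(n\<^sub>1 - n) (1 - y^l) / \<Prod>n\<^sub>i\<close>, where \<open>n\<close> is the index at position \<open>m + 2\<close> and \<open>l\<close> is the
  last one. Fixing \<open>n\<close>, it becomes \<open>\<Sum>n. f\<^sub>y(n) g\<^sub>y(n)\<close>, with \<open>f\<^sub>y\<close> summing over the indices
  before \<open>n\<close> and \<open>g\<^sub>y\<close> over those after it; at \<open>y = 0\<close> this is the zeta star value.

  Independence of \<open>y\<close> comes from the binomial thinning matrix
  \<open>Q(n,k) = (n choose k) y^(n-k) (1-y)^k\<close>. It commutes suitably with division by the index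
  followed by partial summation, on both sides: \<open>g\<^sub>y(n) = \<Sum>k. Q(n,k) g\<^sub>0(k)\<close> by Pascal's rule,
  and \<open>\<Sum>n. Q(n,k) f\<^sub>y(n) = 1 / k^(m+2) = f\<^sub>0(k)\<close> by the hockey stick identity. All terms
  are nonnegative, so the order of summation may be exchanged.
\<close>

section \<open>Exchange of summation for nonnegative families\<close>

lemma has_sum_Sigma_nonneg:
  fixes f :: "'a \<Rightarrow> 'b \<Rightarrow> real"
  assumes "\<And>x. x \<in> A \<Longrightarrow> (f x has_sum g x) (B x)" and "(g has_sum S) A"
    and "\<And>x y. x \<in> A \<Longrightarrow> y \<in> B x \<Longrightarrow> 0 \<le> f x y"
  shows "((\<lambda>(x, y). f x y) has_sum S) (Sigma A B)"
proof (rule has_sum_SigmaI)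
  show "(\<lambda>(x, y). f x y) summable_on Sigma A B"
    by (rule summable_on_SigmaI[where g = g]) (use assms has_sum_imp_summable in auto)
qed (use assms in auto)

text \<open>Both sides slice the same sum over the triangle \<open>k \<le> n \<le> N\<close>, by
  infinite rows \<open>n\<close> or by finite columns \<open>N\<close>. The equivalence serves in
  both directions: from columns to rows in \<open>thin_head_sum_has_sum\<close>, from rows to
  columns in \<open>head_tail_has_sum\<close>.\<close>

lemma has_sum_triangle_swap:
  fixes f :: "nat \<Rightarrow> nat \<Rightarrow> real"
  assumes f: "\<And>n. k \<le> n \<Longrightarrow> (f n has_sum g n) {n..}"
    and nonneg: "\<And>n N. k \<le> n \<Longrightarrow> n \<le> N \<Longrightarrow> 0 \<le> f n N"
  shows "(g has_sum S) {k..} \<longleftrightarrow> ((\<lambda>N. \<Sum>n=k..N. f n N) has_sum S) {k..}"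
proof -
  have bij: "bij_betw prod.swap (SIGMA n:{k..}. {n..}) (SIGMA N:{k..}. {k..N})"
    by (rule bij_betwI[of _ _ _ prod.swap]) auto
  have "(g has_sum S) {k..} \<longleftrightarrow> ((\<lambda>(n, N). f n N) has_sum S) (SIGMA n:{k..}. {n..})"
    using has_sum_Sigma_nonneg[of "{k..}" f "\<lambda>n. {n..}" g S] f nonneg
      has_sum_SigmaD[where f = "\<lambda>(n, N). f n N" and A = "{k..}" and B = "\<lambda>n. {n..}" and g = g and S = S] by auto
  also have "\<dots> \<longleftrightarrow> ((\<lambda>(N, n). f n N) has_sum S) (SIGMA N:{k..}. {k..N})"
    using has_sum_reindex_bij_betw[OF bij, of "\<lambda>(N, n). f n N"]
    by (simp add: case_prod_unfold)
  also have "\<dots> \<longleftrightarrow> ((\<lambda>N. \<Sum>n=k..N. f n N) has_sum S) {k..}"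
    using has_sum_Sigma_nonneg[of "{k..}" "\<lambda>N n. f n N" "\<lambda>N. {k..N}" "\<lambda>N. \<Sum>n=k..N. f n N" S] nonneg
      has_sum_SigmaD[where f = "\<lambda>(N, n). f n N" and A = "{k..}" and B = "\<lambda>N. {k..N}"
          and g = "\<lambda>N. \<Sum>n=k..N. f n N" and S = S]
    by auto
  finally show ?thesis .
qed

section \<open>The binomial thinning matrix and its column sums\<close>

lemma negative_binomial_has_sum:
  fixes y :: real
  assumes "0 \<le> y" "y < 1"
  shows "((\<lambda>n. real (n choose k) * y ^ (n - k)) has_sum 1 / (1 - y) ^ Suc k) {k..}"
proof -
  \<comment> \<open>Newton's series with exponent \<open>-(k+1)\<close> at \<open>-y\<close>. Upper
    negation of the coefficient produces a second sign, which cancels that of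
    \<open>(- y) ^ i\<close>.\<close>
  have "(\<lambda>i. (- real (Suc k) gchoose i) * (- y) ^ i) sums (1 + (- y)) powr (- real (Suc k))"
    using assms by (intro gen_binomial_real) auto
  moreover have "(- real (Suc k) gchoose i) * (- y) ^ i = real (k + i choose k) * y ^ i" for i
  proof -
    have "(- real (Suc k) gchoose i) * (- y) ^ i = ((-1) ^ i * (-1) ^ i) * (real (k + i) gchoose i) * y ^ i"
      by (subst gbinomial_minus, subst power_minus) simp
    also have "(real (k + i) gchoose i) = real (k + i choose i)"
      by (simp add: binomial_gbinomial)
    also have "k + i choose i = k + i choose k"
      by (simp add: binomial_symmetric[of i "k + i"])
    finally show ?thesis by (simp flip: power_mult_distrib)
  qed
  moreover have "(1 + (- y)) powr (- real (Suc k)) = 1 / (1 - y) ^ Suc k"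
    using assms powr_realpow[of "1 - y" "Suc k"]
    by (simp only: powr_minus inverse_eq_divide diff_conv_add_uminus)
  ultimately have "(\<lambda>i. real (k + i choose k) * y ^ i) sums (1 / (1 - y) ^ Suc k)" by simp
  then have "((\<lambda>i. real (k + i choose k) * y ^ i) has_sum (1 / (1 - y) ^ Suc k)) UNIV"
    using assms by (intro sums_nonneg_imp_has_sum) auto
  moreover have "bij_betw (\<lambda>i. k + i) UNIV {k..}"
    by (rule bij_betwI[of _ _ _ "\<lambda>n. n - k"]) auto
  ultimately show ?thesis
    using has_sum_reindex_bij_betw[of "\<lambda>i. k + i" UNIV "{k..}" "\<lambda>n. real (n choose k) * y ^ (n - k)"]
    by simp
qed

text \<open>Row \<open>n\<close> is a binomial distribution: \<open>k\<close> of \<open>n\<close>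
  items survive when each is kept with probability \<open>1 - y\<close>.\<close>

definition thin :: "real \<Rightarrow> nat \<Rightarrow> nat \<Rightarrow> real" where
  "thin y n k = real (n choose k) * y ^ (n - k) * (1 - y) ^ k"

lemma thin_nonneg: "0 \<le> y \<Longrightarrow> y \<le> 1 \<Longrightarrow> 0 \<le> thin y n k"
  by (simp add: thin_def)

lemma thin_eq_0: "n < k \<Longrightarrow> thin y n k = 0"
  by (simp add: thin_def)

text \<open>Pascal's rule: the last item is either lost or kept. The case split isolates the
  truncated exponent \<open>n - Suc k\<close>, which goes wrong only where its coefficient
  vanishes.\<close>

lemma thin_Suc_Suc: "thin y (Suc n) (Suc k) = y * thin y n (Suc k) + (1 - y) * thin y n k"
proof (cases "Suc k \<le> n")
  case True
  then have "y ^ (n - k) = y * y ^ (n - Suc k)"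
    by (metis Suc_diff_Suc Suc_le_lessD power_Suc)
  then show ?thesis by (simp add: thin_def algebra_simps)
qed (auto simp: thin_def binomial_eq_0 not_le less_Suc_eq)

text \<open>The absorption identity for binomial coefficients trades division by the column index
  for division by the row index.\<close>

lemma thin_absorb: "(1 - y) * thin y n k / real (Suc k) = thin y (Suc n) (Suc k) / real (Suc n)"
proof -
  have "real (Suc k) * real (Suc n choose Suc k) = real (Suc n) * real (n choose k)"
    by (metis Suc_times_binomial of_nat_mult)
  then have "real (n choose k) / real (Suc k) = real (Suc n choose Suc k) / real (Suc n)"
    by (simp add: field_simps del: binomial_Suc_Suc of_nat_Suc)
  then have "real (n choose k) / real (Suc k) * y ^ (n - k) * (1 - y) ^ Suc k
      = real (Suc n choose Suc k) / real (Suc n) * y ^ (n - k) * (1 - y) ^ Suc k" by simp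
  then show ?thesis unfolding thin_def by (simp add: mult_ac del: binomial_Suc_Suc of_nat_Suc)
qed

text \<open>Hockey stick identity, shifted by one. At \<open>k = 0\<close> truncated subtraction
  would make the left side \<open>N + 1\<close>.\<close>

lemma sum_binomial_pred:
  assumes "1 \<le> k"
  shows "(\<Sum>n=k..N. (n - 1) choose (k - 1)) = N choose k"
proof (induction N)
  case (Suc N)
  from assms obtain l where "k = Suc l" by (cases k) auto
  with Suc show ?case by (cases "k \<le> Suc N") (auto simp: not_le)
qed (use assms in auto)

lemma thin_divide:
  assumes "1 \<le> k" "k \<le> n"
  shows "thin y n k / real n = real ((n - 1) choose (k - 1)) * y ^ (n - k) * (1 - y) ^ k / real k"
proof -
  obtain l p where [simp]: "k = Suc l" "n = Suc p" using assms by (cases k; cases n) auto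
  show ?thesis using thin_absorb[of y p l] by (simp add: thin_def mult_ac del: binomial_Suc_Suc of_nat_Suc)
qed

text \<open>After absorption this is the negative binomial series for \<open>k - 1\<close>, shifted
  by one. It starts the induction in \<open>thin_head_sum_has_sum\<close>.\<close>

lemma thin_has_sum:
  assumes "0 \<le> y" "y < 1" "1 \<le> k"
  shows "((\<lambda>n. thin y n k / real n) has_sum 1 / real k) {k..}"
proof -
  obtain l where k: "k = Suc l" using assms by (cases k) auto
  have "((\<lambda>n. (1 - y) ^ k / real k * (real (n choose l) * y ^ (n - l)))
      has_sum ((1 - y) ^ k / real k * (1 / (1 - y) ^ k))) {l..}"
    unfolding k by (intro has_sum_cmult_right negative_binomial_has_sum assms)
  moreover have "bij_betw Suc {l..} {k..}"
    by (rule bij_betwI[of _ _ _ "\<lambda>n. n - 1"]) (auto simp: k)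
  moreover have "(1 - y) ^ k / real k * (real (n choose l) * y ^ (n - l)) = thin y (Suc n) k / real (Suc n)"
    if "n \<in> {l..}" for n
    using thin_divide[of k "Suc n" y] that by (simp add: k mult_ac)
  ultimately show ?thesis
    using has_sum_reindex_bij_betw[of Suc "{l..}" "{k..}" "\<lambda>n. thin y n k / real n"] assms
      has_sum_cong[of "{l..}" "\<lambda>n. (1 - y) ^ k / real k * (real (n choose l) * y ^ (n - l))" 
         "\<lambda>n. thin y (Suc n) k / real (Suc n)"]
    by simp
qed

text \<open>The powers of \<open>y\<close> merge into \<open>y ^ (N - k)\<close>, independent of
  \<open>n\<close>, and the hockey stick identity sums what remains.\<close>

lemma sum_thin_divide:
  assumes "1 \<le> k"
  shows "(\<Sum>n=k..N. thin y n k / real n * y ^ (N - n)) = thin y N k / real k"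
proof -
  have "(\<Sum>n=k..N. thin y n k / real n * y ^ (N - n))
     = (\<Sum>n=k..N. real ((n - 1) choose (k - 1)) * (y ^ (N - k) * (1 - y) ^ k / real k))"
  proof (rule sum.cong)
    fix n assume n: "n \<in> {k..N}"
    then have eq: "y ^ (n - k) * y ^ (N - n) = y ^ (N - k)" by (simp flip: power_add)
    have "thin y n k / real n * y ^ (N - n)
      = real ((n - 1) choose (k - 1)) * ((y ^ (n - k) * y ^ (N - n)) * (1 - y) ^ k / real k)"
      using thin_divide[of k n y] assms n by simp
    then show "thin y n k / real n * y ^ (N - n)
      = real ((n - 1) choose (k - 1)) * (y ^ (N - k) * (1 - y) ^ k / real k)"
      by (simp only: eq)
  qed simp
  also have "\<dots> = real (\<Sum>n=k..N. (n - 1) choose (k - 1)) * (y ^ (N - k) * (1 - y) ^ k / real k)"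
    by (simp add: sum_distrib_right sum_divide_distrib)
  finally show ?thesis by (simp only: sum_binomial_pred[OF assms]) (simp add: thin_def)
qed

section \<open>Sums over the indices before the marked index\<close>

text \<open>The exponent \<open>n_1 - n\<close> telescopes over neighbouring indices, so each step
  contributes one factor \<open>y ^ (N - n)\<close>; the marked index contributes its own
  reciprocal. A divergent sum would default to 0, so convergence is established separately.\<close>

primrec head_sum :: "real \<Rightarrow> nat \<Rightarrow> nat \<Rightarrow> real" where
  "head_sum y 0 n = 1 / real n"
| "head_sum y (Suc j) n = (\<Sum>\<^sub>\<infinity>N\<in>{n..}. y ^ (N - n) * head_sum y j N) / real n"

lemma head_sum_nonneg: "0 \<le> y \<Longrightarrow> 0 \<le> head_sum y j n"
  by (induction j arbitrary: n) (auto intro!: infsum_nonneg divide_nonneg_nonneg)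

text \<open>Column 1 of the matrix is \<open>N * y ^ (N - 1) * (1 - y)\<close>. Divided by
  \<open>y ^ (n - 1) * (1 - y)\<close> it becomes \<open>N * y ^ (N - n)\<close>, which dominates
  the required weight because \<open>N \<ge> 1\<close>.\<close>

lemma head_sum_Suc_has_sumI:
  assumes y: "0 < y" "y < 1" and n: "1 \<le> n"
    and summable: "(\<lambda>N. thin y N 1 * head_sum y j N) summable_on {1..}"
  shows "((\<lambda>N. y ^ (N - n) * head_sum y j N / real n) has_sum head_sum y (Suc j) n) {n..}"
proof -
  have "(\<lambda>N. 1 / (y ^ (n - 1) * (1 - y)) * (thin y N 1 * head_sum y j N)) summable_on {n..}"
    using n by (intro summable_on_cmult_right summable_on_subset[OF summable]) auto
  then have "(\<lambda>N. y ^ (N - n) * head_sum y j N) summable_on {n..}"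
  proof (rule summable_on_comparison_test)
    fix N assume N: "N \<in> {n..}"
    then have "y ^ (N - 1) = y ^ (N - n) * y ^ (n - 1)" using n by (simp flip: power_add)
    then have "1 / (y ^ (n - 1) * (1 - y)) * (thin y N 1 * head_sum y j N)
        = real N * (y ^ (N - n) * head_sum y j N)"
      using y by (simp add: thin_def field_simps)
    moreover have "0 \<le> (real N - 1) * (y ^ (N - n) * head_sum y j N)"
      using N n y head_sum_nonneg[of y j N] by (intro mult_nonneg_nonneg) auto
    ultimately show "y ^ (N - n) * head_sum y j N
        \<le> 1 / (y ^ (n - 1) * (1 - y)) * (thin y N 1 * head_sum y j N)"
      by (simp add: algebra_simps)
  qed (use y head_sum_nonneg[of y j] in auto)
  then show ?thesis
    unfolding head_sum.simps divide_inverse by (intro has_sum_cmult_left has_sum_infsum)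
qed

text \<open>Swapping the sums over \<open>n \<le> N\<close> leaves a finite inner sum, which
  \<open>sum_thin_divide\<close> evaluates to \<open>thin y N k / k\<close>. So each index before
  the marked one adds a factor \<open>1 / k\<close>.\<close>

lemma thin_head_sum_has_sum:
  assumes y: "0 < y" "y < 1" and k: "1 \<le> k"
  shows "((\<lambda>n. thin y n k * head_sum y j n) has_sum 1 / real k ^ Suc j) {k..}"
  using k
proof (induction j arbitrary: k)
  case 0
  then show ?case using thin_has_sum[of y k] y by simp
next
  case (Suc j)
  let ?f = "\<lambda>n N. thin y n k * (y ^ (N - n) * head_sum y j N / real n)"
  \<comment> \<open>Column 1 of the induction hypothesis supplies the convergence of the next
    \<open>head_sum\<close>, which is why \<open>k\<close> is arbitrary in the induction.\<close>
  have sm: "(\<lambda>N. thin y N 1 * head_sum y j N) summable_on {1..}"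
    using Suc.IH[of 1] has_sum_imp_summable by blast
  have "((\<lambda>n. thin y n k * head_sum y (Suc j) n) has_sum 1 / real k ^ Suc (Suc j)) {k..} \<longleftrightarrow>
     ((\<lambda>N. \<Sum>n=k..N. ?f n N) has_sum 1 / real k ^ Suc (Suc j)) {k..}"
  proof (rule has_sum_triangle_swap)
    show "(?f n has_sum thin y n k * head_sum y (Suc j) n) {n..}" if "k \<le> n" for n
      using that Suc.prems by (intro has_sum_cmult_right head_sum_Suc_has_sumI y sm) auto
  qed (use y head_sum_nonneg[of y j] thin_nonneg[of y] in auto)
  also have "(\<lambda>N. \<Sum>n=k..N. ?f n N) = (\<lambda>N. thin y N k * head_sum y j N * (1 / real k))"
  proof
    fix N
    have "(\<Sum>n=k..N. ?f n N) = (\<Sum>n=k..N. thin y n k / real n * y ^ (N - n)) * head_sum y j N"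
      unfolding sum_distrib_right by (intro sum.cong) simp_all
    then show "(\<Sum>n=k..N. ?f n N) = thin y N k * head_sum y j N * (1 / real k)"
      by (simp only: sum_thin_divide[OF Suc.prems]) simp
  qed
  finally show ?case
    using has_sum_cmult_left[OF Suc.IH[OF Suc.prems], of "1 / real k"] by (simp add: mult_ac)
qed

lemma head_sum_Suc_has_sum:
  assumes "0 < y" "y < 1" "1 \<le> n"
  shows "((\<lambda>N. y ^ (N - n) * head_sum y j N / real n) has_sum head_sum y (Suc j) n) {n..}"
  using assms thin_head_sum_has_sum[of y 1 j] has_sum_imp_summable
  by (intro head_sum_Suc_has_sumI) auto

section \<open>Sums over the indices after the marked index\<close>

text \<open>The base case is the weight of the last index; with no indices after \<open>n\<close>,
  that is \<open>n\<close> itself.\<close>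

primrec tail_sum :: "real \<Rightarrow> nat \<Rightarrow> nat \<Rightarrow> real" where
  "tail_sum y 0 n = 1 - y ^ n"
| "tail_sum y (Suc s) n = (\<Sum>j=1..n. tail_sum y s j / real j)"

lemma tail_sum_0_right [simp]: "tail_sum y s 0 = 0"
  by (cases s) auto

lemma tail_sum_nonneg: "0 \<le> y \<Longrightarrow> y \<le> 1 \<Longrightarrow> 0 \<le> tail_sum y s n"
  by (induction s arbitrary: n) (auto intro!: sum_nonneg power_le_one divide_nonneg_nonneg)

text \<open>Pascal's rule tested against a sequence \<open>h\<close>: a kept item shifts
  \<open>h\<close> by one. The surplus term \<open>k = Suc n\<close> vanishes by
  \<open>thin_eq_0\<close>.\<close>

lemma sum_thin_Suc:
  fixes h :: "nat \<Rightarrow> real"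
  shows "(\<Sum>k\<le>Suc n. thin y (Suc n) k * h k)
     = y * (\<Sum>k\<le>n. thin y n k * h k) + (1 - y) * (\<Sum>k\<le>n. thin y n k * h (Suc k))"
proof -
  have "(\<Sum>k\<le>Suc n. thin y (Suc n) k * h k)
     = thin y (Suc n) 0 * h 0 + (\<Sum>k\<le>n. thin y (Suc n) (Suc k) * h (Suc k))"
    by (rule sum.atMost_Suc_shift)
  also have "\<dots> = y * (thin y n 0 * h 0 + (\<Sum>k\<le>n. thin y n (Suc k) * h (Suc k)))
     + (1 - y) * (\<Sum>k\<le>n. thin y n k * h (Suc k))"
  proof -
    have "(\<Sum>k\<le>n. thin y (Suc n) (Suc k) * h (Suc k))
      = y * (\<Sum>k\<le>n. thin y n (Suc k) * h (Suc k)) + (1 - y) * (\<Sum>k\<le>n. thin y n k * h (Suc k))"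
      by (simp only: thin_Suc_Suc distrib_right sum.distrib sum_distrib_left mult.assoc)
    moreover have "thin y (Suc n) 0 = y * thin y n 0" by (simp add: thin_def)
    ultimately show ?thesis by (simp add: algebra_simps)
  qed
  also have "thin y n 0 * h 0 + (\<Sum>k\<le>n. thin y n (Suc k) * h (Suc k)) = (\<Sum>k\<le>Suc n. thin y n k * h k)"
    by (rule sum.atMost_Suc_shift[symmetric])
  finally show ?thesis by (simp add: thin_eq_0)
qed

text \<open>With \<open>0 ^ 0 = 1\<close>, the weight \<open>1 - 0 ^ k\<close> in \<open>tail_sum 0\<close> is \<open>1\<close> for \<open>k \<ge> 1\<close> and \<open>0\<close> for \<open>k = 0\<close>.\<close>

lemma tail_sum_thin: "tail_sum y s n = (\<Sum>k\<le>n. thin y n k * tail_sum 0 s k)"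
proof (induction s arbitrary: n)
  case 0
  \<comment> \<open>Rows sum to 1 by the binomial theorem; the weight \<open>1 - 0 ^ k\<close>
    removes just the entry \<open>y ^ n\<close> at \<open>k = 0\<close>.\<close>
  have "1 = ((1 - y) + y) ^ n" by simp
  also have "\<dots> = (\<Sum>k\<le>n. thin y n k)"
    unfolding binomial_ring thin_def by (intro sum.cong) (auto simp: mult_ac)
  also have "\<dots> = (\<Sum>k\<le>n. thin y n k * tail_sum 0 0 k + (if k = 0 then y ^ n else 0))"
    by (intro sum.cong) (auto simp: thin_def)
  finally show ?case by (simp add: sum.distrib)
next
  case (Suc s)
  show ?case
  proof (induction n)
    case (Suc n)
    let ?G = "tail_sum 0 (Suc s)"
    \<comment> \<open>The term \<open>k = 0\<close> drops out since
      \<open>tail_sum 0 s 0 = 0\<close>; absorption then rewrites the remaining terms.\<close>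
    have "(\<Sum>k\<le>Suc n. thin y (Suc n) k * tail_sum 0 s k) / real (Suc n)
      = (\<Sum>k\<le>n. thin y (Suc n) (Suc k) / real (Suc n) * tail_sum 0 s (Suc k))"
      by (simp only: sum.atMost_Suc_shift) (simp add: sum_divide_distrib)
    also have "\<dots> = (\<Sum>k\<le>n. (1 - y) * (thin y n k * (tail_sum 0 s (Suc k) / real (Suc k))))"
      by (intro sum.cong) (simp_all only: thin_absorb[symmetric] times_divide_eq_left times_divide_eq_right mult.assoc)
    also have "\<dots> = (1 - y) * (\<Sum>k\<le>n. thin y n k * (tail_sum 0 s (Suc k) / real (Suc k)))"
      by (simp only: sum_distrib_left)
    finally have "tail_sum y s (Suc n) / real (Suc n)
      = (1 - y) * (\<Sum>k\<le>n. thin y n k * (tail_sum 0 s (Suc k) / real (Suc k)))"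
      by (simp only: \<open>\<And>n. tail_sum y s n = _ n\<close>)
    \<comment> \<open>With \<open>?G (Suc k)\<close> split into \<open>?G k\<close> and its
      increment, \<open>sum_thin_Suc\<close> shows that the transform of \<open>?G\<close> grows
      from \<open>n\<close> to \<open>Suc n\<close> exactly as \<open>tail_sum y (Suc s)\<close>
      does.\<close>
    moreover have "(\<Sum>k\<le>n. thin y n k * ?G (Suc k)) = (\<Sum>k\<le>n. thin y n k * ?G k)
       + (\<Sum>k\<le>n. thin y n k * (tail_sum 0 s (Suc k) / real (Suc k)))"
      by (simp add: distrib_left flip: sum.distrib)
    moreover have "tail_sum y (Suc s) (Suc n) = tail_sum y (Suc s) n + tail_sum y s (Suc n) / real (Suc n)"
      by simp
    ultimately show ?case
      unfolding sum_thin_Suc Suc.IH by (simp only: distrib_left left_diff_distrib)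
  qed simp
qed

section \<open>Growth of the tail sums and convergence\<close>

lemma sum_inverse_sqrt_le: "(\<Sum>j=1..n. 1 / sqrt (real j)) \<le> 2 * sqrt (real n)"
proof (induction n)
  case (Suc n)
  let ?a = "sqrt (real n)" and ?b = "sqrt (real (Suc n))"
  \<comment> \<open>The bound telescopes once \<open>1 / ?b \<le> 2 * (?b - ?a)\<close>, which
    follows from this identity and \<open>(?b - ?a)\<^sup>2 \<ge> 0\<close>.\<close>
  have "?b\<^sup>2 - ?a\<^sup>2 = 1" by simp
  then have "(?b - ?a) * (?b + ?a) = 1" by (simp add: power2_eq_square algebra_simps)
  moreover have "(?b - ?a) * (?b + ?a) \<le> 2 * (?b - ?a) * ?b"
  proof -
    have "(b - a) * (b + a) \<le> 2 * (b - a) * b" for a b :: real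
      using zero_le_power2[of "b - a"] by (simp add: power2_eq_square algebra_simps)
    then show ?thesis .
  qed
  ultimately have "1 / ?b \<le> 2 * (?b - ?a)" 
    by (subst pos_divide_le_eq) (simp, linarith)
  with Suc show ?case by simp
qed simp

text \<open>A crude bound that reproduces itself, up to a factor 2, under division by the index and
  partial summation, yet leaves a convergent series after division by the square of the
  index.\<close>

lemma tail_sum_le_sqrt:
  assumes "0 \<le> y"
  shows "tail_sum y s n \<le> 2 ^ s * sqrt (real n)"
proof (induction s arbitrary: n)
  case 0
  show ?case
  proof (cases "n = 0")
    case False
    then have "1 \<le> sqrt (real n)" by simp
    moreover have "0 \<le> y ^ n" using assms by simp
    ultimately have "1 - y ^ n \<le> sqrt (real n)" by linarith
    then show ?thesis by simp
  qed simp
next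
  case (Suc s)
  have "tail_sum y (Suc s) n \<le> (\<Sum>j=1..n. 2 ^ s * (1 / sqrt (real j)))"
    unfolding tail_sum.simps
  proof (rule sum_mono)
    fix j assume "j \<in> {1..n}"
    then have "tail_sum y s j / real j \<le> 2 ^ s * sqrt (real j) / real j"
      by (intro divide_right_mono Suc) auto
    also have "\<dots> = 2 ^ s * (1 / sqrt (real j))"
      using \<open>j \<in> {1..n}\<close> by (simp add: field_simps)
    finally show "tail_sum y s j / real j \<le> 2 ^ s * (1 / sqrt (real j))" .
  qed
  also have "\<dots> \<le> 2 ^ s * (2 * sqrt (real n))"
    unfolding sum_distrib_left[symmetric] by (intro mult_left_mono sum_inverse_sqrt_le) auto
  finally show ?case by simp
qed

lemma tail_sum_summable:
  assumes "0 \<le> y" "y \<le> 1"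
  shows "(\<lambda>n. 1 / real n ^ (m + 2) * tail_sum y s n) summable_on {1..}"
proof -
  have "summable (\<lambda>n. real n powr (-3/2))" by (subst summable_real_powr_iff) simp
  then have "(\<lambda>n. real n powr (-3/2)) summable_on UNIV"
    by (intro summable_nonneg_imp_summable_on) auto
  then have "(\<lambda>n. 2 ^ s * real n powr (-3/2)) summable_on {1..}"
    by (intro summable_on_cmult_right) (rule summable_on_subset, auto)
  then show ?thesis
  proof (rule summable_on_comparison_test)
    fix n :: nat assume n: "n \<in> {1..}"
    \<comment> \<open>The case \<open>m = 0\<close> is the worst one and gives the exponent
      \<open>1/2 - 2 = -3/2\<close>.\<close>
    have "1 / real n ^ (m + 2) * tail_sum y s n \<le> 1 / real n ^ 2 * (2 ^ s * sqrt (real n))"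
    proof (rule mult_mono)
      show "1 / real n ^ (m + 2) \<le> 1 / real n ^ 2"
        using n by (intro divide_left_mono power_increasing) auto
    qed (use assms tail_sum_nonneg tail_sum_le_sqrt in auto)
    also have "\<dots> = 2 ^ s * (real n powr (1/2) / real n powr 2)"
      using n by (simp add: powr_half_sqrt powr_numeral)
    also have "\<dots> = 2 ^ s * real n powr (-3/2)"
      by (simp only: powr_diff[symmetric]) simp
    finally show "1 / real n ^ (m + 2) * tail_sum y s n \<le> 2 ^ s * real n powr (-3/2)" .
  qed (use assms tail_sum_nonneg in auto)
qed

text \<open>Expanding \<open>tail_sum y s n\<close> by \<open>tail_sum_thin\<close> and summing over
  \<open>n\<close> first leaves the column sums \<open>1 / k ^ Suc j\<close>, so the total does not
  depend on \<open>y\<close>.\<close>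

lemma head_tail_has_sum:
  assumes y: "0 < y" "y < 1"
    and S: "((\<lambda>k. 1 / real k ^ Suc j * tail_sum 0 s k) has_sum S) {1..}"
  shows "((\<lambda>n. head_sum y j n * tail_sum y s n) has_sum S) {1..}"
proof -
  let ?f = "\<lambda>k n. thin y n k * head_sum y j n * tail_sum 0 s k"
  have "((\<lambda>k. 1 / real k ^ Suc j * tail_sum 0 s k) has_sum S) {1..} \<longleftrightarrow>
     ((\<lambda>n. \<Sum>k=1..n. ?f k n) has_sum S) {1..}"
  proof (rule has_sum_triangle_swap)
    show "(?f k has_sum 1 / real k ^ Suc j * tail_sum 0 s k) {k..}" if "1 \<le> k" for k
      using that by (intro has_sum_cmult_left thin_head_sum_has_sum y)
  qed (use y head_sum_nonneg[of y j] thin_nonneg[of y] tail_sum_nonneg[of 0] in auto)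
  also have "(\<lambda>n. \<Sum>k=1..n. ?f k n) = (\<lambda>n. head_sum y j n * tail_sum y s n)"
  proof
    fix n
    \<comment> \<open>The term \<open>k = 0\<close> can be omitted because
      \<open>tail_sum 0 s 0 = 0\<close>.\<close>
    have "tail_sum y s n = (\<Sum>k=1..n. thin y n k * tail_sum 0 s k)"
      unfolding tail_sum_thin[of y] by (rule sum.mono_neutral_right) (auto simp: not_less_eq_eq)
    then show "(\<Sum>k=1..n. ?f k n) = head_sum y j n * tail_sum y s n"
      by (simp add: sum_distrib_left mult_ac)
  qed
  finally show ?thesis using S by blast
qed

section \<open>Index lists split at a marked position\<close>

definition lists_above :: "nat \<Rightarrow> nat \<Rightarrow> nat list set" where
  "lists_above n j = {xs. length xs = j \<and> sorted_wrt (\<ge>) xs \<and> (\<forall>x\<in>set xs. n \<le> x)}"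

definition lists_below :: "nat \<Rightarrow> nat \<Rightarrow> nat list set" where
  "lists_below n s = {zs. length zs = s \<and> sorted_wrt (\<ge>) zs \<and> (\<forall>z\<in>set zs. 1 \<le> z \<and> z \<le> n)}"

definition recip_prod :: "nat list \<Rightarrow> real" where
  "recip_prod ns = prod_list (map (\<lambda>n. 1 / real n) ns)"

lemma recip_prod_simps [simp]:
  "recip_prod [] = 1"
  "recip_prod (n # ns) = recip_prod ns / real n"
  "recip_prod (xs @ ns) = recip_prod xs * recip_prod ns"
  by (simp_all add: recip_prod_def)

lemma recip_prod_nonneg: "0 \<le> recip_prod ns"
  by (induction ns) auto

lemma lists_above_0 [simp]: "lists_above n 0 = {[]}"
  by (auto simp: lists_above_def)

lemma lists_below_0 [simp]: "lists_below n 0 = {[]}"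
  by (auto simp: lists_below_def)

text \<open>The entry next to the marked index is split off: the last one here, the first one for
  \<open>lists_below\<close>. This matches the recursions of \<open>head_sum\<close> and
  \<open>tail_sum\<close>.\<close>

lemma bij_betw_lists_above_Suc:
  "bij_betw (\<lambda>(N, xs). xs @ [N]) (SIGMA N:{n..}. lists_above N j) (lists_above n (Suc j))"
proof (rule bij_betwI[where g = "\<lambda>xs. (last xs, butlast xs)"])
  show "(\<lambda>xs. (last xs, butlast xs)) \<in> lists_above n (Suc j) \<rightarrow> (SIGMA N:{n..}. lists_above N j)"
  proof
    fix xs assume xs: "xs \<in> lists_above n (Suc j)"
    then have "xs \<noteq> []" by (auto simp: lists_above_def)
    then obtain ys N where "xs = ys @ [N]" by (metis rev_exhaust)
    with xs show "(last xs, butlast xs) \<in> (SIGMA N:{n..}. lists_above N j)"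
      by (auto simp: lists_above_def sorted_wrt_append)
  qed
  show "(\<lambda>(N, xs). xs @ [N]) (last xs, butlast xs) = xs" if "xs \<in> lists_above n (Suc j)" for xs
  proof -
    have "xs \<noteq> []" using that by (auto simp: lists_above_def)
    then show ?thesis by simp
  qed
qed (fastforce simp: lists_above_def sorted_wrt_append)+

lemma bij_betw_lists_below_Suc:
  "bij_betw (\<lambda>(i, zs). i # zs) (SIGMA i:{1..n}. lists_below i s) (lists_below n (Suc s))"
proof (rule bij_betwI[where g = "\<lambda>zs. (hd zs, tl zs)"])
  show "(\<lambda>zs. (hd zs, tl zs)) \<in> lists_below n (Suc s) \<rightarrow> (SIGMA i:{1..n}. lists_below i s)"
    by (auto simp: lists_below_def length_Suc_conv)
  show "(\<lambda>(i, zs). i # zs) (hd zs, tl zs) = zs" if "zs \<in> lists_below n (Suc s)" for zs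
    using that by (auto simp: lists_below_def length_Suc_conv)
qed (fastforce simp: lists_below_def)+

lemma finite_lists_below: "finite (lists_below n s)"
  by (rule finite_subset[OF _ finite_lists_length_eq[of "{1..n}" s]]) (auto simp: lists_below_def)

text \<open>Once the entry \<open>n\<close> at position \<open>j\<close> is fixed, monotonicity
  constrains the entries before and after it independently.\<close>

lemma bij_betw_star_indices:
  "bij_betw (\<lambda>(n, xs, zs). xs @ n # zs) (SIGMA n:{1..}. lists_above n j \<times> lists_below n s)
     (star_indices (j + 1 + s))"
proof (rule bij_betwI[where g = "\<lambda>ns. (ns ! j, take j ns, drop (Suc j) ns)"])
  show "(\<lambda>ns. (ns ! j, take j ns, drop (Suc j) ns)) \<in> star_indices (j + 1 + s) \<rightarrow>
     (SIGMA n:{1..}. lists_above n j \<times> lists_below n s)"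
  proof
    fix ns assume ns: "ns \<in> star_indices (j + 1 + s)"
    then have "ns = take j ns @ ns ! j # drop (Suc j) ns"
      by (intro id_take_nth_drop) (simp add: star_indices_def)
    moreover have "length (take j ns) = j" "length (drop (Suc j) ns) = s"
      using ns by (auto simp: star_indices_def)
    ultimately obtain xs n zs where "ns = xs @ n # zs" "length xs = j" "length zs = s" by metis
    with ns show "(ns ! j, take j ns, drop (Suc j) ns) \<in> (SIGMA n:{1..}. lists_above n j \<times> lists_below n s)"
      by (auto simp: star_indices_def lists_above_def lists_below_def sorted_wrt_append nth_append)
  qed
  show "(\<lambda>(n, xs, zs). xs @ n # zs) (ns ! j, take j ns, drop (Suc j) ns) = ns"
    if "ns \<in> star_indices (j + 1 + s)" for ns
  proof -
    have "j < length ns" using that by (simp add: star_indices_def)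
    then show ?thesis by (simp flip: id_take_nth_drop)
  qed
qed (fastforce simp: star_indices_def lists_above_def lists_below_def sorted_wrt_append nth_append)+

text \<open>\<open>hd (xs @ [n])\<close> is the largest index, namely \<open>n\<close> if
  \<open>xs\<close> is empty, so one exponent covers both cases.\<close>

lemma head_sum_lists:
  assumes y: "0 < y" "y < 1" and n: "1 \<le> n"
  shows "((\<lambda>xs. y ^ (hd (xs @ [n]) - n) * recip_prod (xs @ [n])) has_sum head_sum y j n) (lists_above n j)"
  using n
proof (induction j arbitrary: n)
  case 0
  show ?case by (auto intro!: has_sum_finiteI)
next
  case (Suc j)
  have hd_ge: "N \<le> hd (xs @ [N])" if "xs \<in> lists_above N j" for N xs
    using that by (cases xs) (auto simp: lists_above_def)
  let ?f = "\<lambda>N xs. y ^ (N - n) / real n * (y ^ (hd (xs @ [N]) - N) * recip_prod (xs @ [N]))"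
  have "((\<lambda>(N, xs). ?f N xs) has_sum head_sum y (Suc j) n) (SIGMA N:{n..}. lists_above N j)"
  proof (rule has_sum_Sigma_nonneg)
    show "(?f N has_sum y ^ (N - n) / real n * head_sum y j N) (lists_above N j)" if "N \<in> {n..}" for N
      using that Suc.prems by (intro has_sum_cmult_right Suc.IH) auto
    show "((\<lambda>N. y ^ (N - n) / real n * head_sum y j N) has_sum head_sum y (Suc j) n) {n..}"
      using head_sum_Suc_has_sum[OF y Suc.prems] by simp
  qed (use y recip_prod_nonneg in simp)
  also have "?this \<longleftrightarrow> ((\<lambda>(N, xs). y ^ (hd ((xs @ [N]) @ [n]) - n) * recip_prod ((xs @ [N]) @ [n]))
      has_sum head_sum y (Suc j) n) (SIGMA N:{n..}. lists_above N j)"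
  proof (rule has_sum_cong)
    fix p assume "p \<in> (SIGMA N:{n..}. lists_above N j)"
    then obtain N xs where p: "p = (N, xs)" and N: "N \<in> {n..}" and xs: "xs \<in> lists_above N j"
      by blast
    \<comment> \<open>The truncated differences add up because
      \<open>n \<le> N \<le> hd (xs @ [N])\<close>.\<close>
    have "y ^ (hd (xs @ [N]) - n) = y ^ (N - n) * y ^ (hd (xs @ [N]) - N)"
      using hd_ge[OF xs] N by (simp flip: power_add)
    then have "?f N xs = y ^ (hd ((xs @ [N]) @ [n]) - n) * recip_prod ((xs @ [N]) @ [n])"
      by (cases xs) auto
    then show "(case p of (N, xs) \<Rightarrow> ?f N xs)
        = (case p of (N, xs) \<Rightarrow> y ^ (hd ((xs @ [N]) @ [n]) - n) * recip_prod ((xs @ [N]) @ [n]))"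
      by (simp add: p)
  qed
  finally show ?case
    using has_sum_reindex_bij_betw[OF bij_betw_lists_above_Suc,
        of "\<lambda>xs. y ^ (hd (xs @ [n]) - n) * recip_prod (xs @ [n])"]
    by (simp add: case_prod_unfold)
qed

lemma tail_sum_lists:
  "(\<Sum>zs\<in>lists_below n s. (1 - y ^ last (n # zs)) * recip_prod zs) = tail_sum y s n"
proof (induction s arbitrary: n)
  case (Suc s)
  have "(\<Sum>zs\<in>lists_below n (Suc s). (1 - y ^ last (n # zs)) * recip_prod zs)
     = (\<Sum>(i, zs)\<in>(SIGMA i:{1..n}. lists_below i s). (1 - y ^ last (i # zs)) * recip_prod zs / real i)"
    by (simp add: sum.reindex_bij_betw[OF bij_betw_lists_below_Suc, symmetric] case_prod_unfold
        del: last.simps) simp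
  also have "\<dots> = tail_sum y (Suc s) n"
    by (subst sum.Sigma[symmetric]) (simp_all add: finite_lists_below flip: Suc sum_divide_distrib)
  finally show ?case .
qed simp

text \<open>For fixed \<open>n\<close> the summand factors, so its sum is a product; nonnegativity
  then gives summability over all splittings.\<close>

lemma split_has_sum:
  fixes a b :: "nat \<Rightarrow> nat list \<Rightarrow> real"
  assumes a: "\<And>n. 1 \<le> n \<Longrightarrow> (a n has_sum A n) (lists_above n j)"
    and b: "\<And>n. 1 \<le> n \<Longrightarrow> (\<Sum>zs\<in>lists_below n s. b n zs) = B n"
    and nonneg: "\<And>n xs. 0 \<le> a n xs" "\<And>n zs. zs \<in> lists_below n s \<Longrightarrow> 0 \<le> b n zs"
    and S: "((\<lambda>n. A n * B n) has_sum S) {1..}"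
  shows "((\<lambda>(n, xs, zs). a n xs * b n zs) has_sum S) (SIGMA n:{1..}. lists_above n j \<times> lists_below n s)"
proof (rule has_sum_Sigma_nonneg[where f = "\<lambda>n (xs, zs). a n xs * b n zs"])
  fix n :: nat assume "n \<in> {1..}"
  then have n: "1 \<le> n" by simp
  show "((\<lambda>(xs, zs). a n xs * b n zs) has_sum A n * B n) (lists_above n j \<times> lists_below n s)"
  proof (rule has_sum_Sigma_nonneg)
    show "((\<lambda>zs. a n xs * b n zs) has_sum a n xs * B n) (lists_below n s)" for xs
      using b[OF n] by (intro has_sum_cmult_right has_sum_finiteI finite_lists_below) simp
  qed (use nonneg a[OF n] in \<open>auto intro: has_sum_cmult_left\<close>)
qed (use nonneg S in auto)

section \<open>The zeta star value as a single series\<close>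

lemma zeta_star_term:
  "(\<Prod>i<length ([m] @ replicate s 1). 1 / real ((n # zs) ! i) ^ (([m] @ replicate s 1) ! i))
     = 1 / real n ^ m * recip_prod zs" if "length zs = s"
proof -
  have "recip_prod zs = (\<Prod>i<s. 1 / real (zs ! i))"
    using that by (simp add: recip_prod_def prod.list_conv_set_nth atLeast0LessThan)
  then show ?thesis
    by (simp add: prod.lessThan_Suc_shift del: prod.lessThan_Suc)
qed

lemma zeta_star_has_sum:
  "((\<lambda>n. 1 / real n ^ (m + 2) * tail_sum 0 s n) has_sum zeta_star ([m + 2] @ replicate s 1)) {1..}"
proof -
  \<comment> \<open>Convergence comes first, so that \<open>zeta_star\<close> is a genuine sum and
    not the default value.\<close>
  obtain S where S: "((\<lambda>n. 1 / real n ^ (m + 2) * tail_sum 0 s n) has_sum S) {1..}"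
    using tail_sum_summable[of 0 m s] by (auto simp: summable_on_def)
  have "((\<lambda>(n, xs, zs). 1 / real n ^ (m + 2) * ((1 - 0 ^ last (n # zs)) * recip_prod zs)) has_sum S)
      (SIGMA n:{1..}. lists_above n 0 \<times> lists_below n s)"
    by (rule split_has_sum[OF _ tail_sum_lists _ _ S])
      (auto simp: recip_prod_nonneg power_le_one intro: has_sum_finiteI)
  also have "?this \<longleftrightarrow> ((\<lambda>(n, xs, zs). \<Prod>i<length ([m + 2] @ replicate s 1).
      1 / real ((xs @ n # zs) ! i) ^ (([m + 2] @ replicate s 1) ! i)) has_sum S)
      (SIGMA n:{1..}. lists_above n 0 \<times> lists_below n s)"
  proof (rule has_sum_cong)
    fix p assume "p \<in> (SIGMA n:{1..}. lists_above n 0 \<times> lists_below n s)"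
    then obtain n zs where p: "p = (n, [], zs)" and n: "1 \<le> n" and zs: "zs \<in> lists_below n s"
      by auto
    \<comment> \<open>All indices are positive, so the weight \<open>1 - 0 ^ last (n # zs)\<close>
      is 1.\<close>
    have "last (n # zs) \<in> set (n # zs)" by (rule last_in_set) simp
    then have "last (n # zs) \<noteq> 0" using n zs by (auto simp: lists_below_def simp del: last.simps)
    then show "(case p of (n, xs, zs) \<Rightarrow> 1 / real n ^ (m + 2) * ((1 - 0 ^ last (n # zs)) * recip_prod zs))
      = (case p of (n, xs, zs) \<Rightarrow> \<Prod>i<length ([m + 2] @ replicate s 1).
          1 / real ((xs @ n # zs) ! i) ^ (([m + 2] @ replicate s 1) ! i))"
      using zeta_star_term[of zs s n "m + 2"] zs
      by (simp add: p lists_below_def zero_power del: last.simps)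
  qed
  finally have "((\<lambda>ns. \<Prod>i<length ([m + 2] @ replicate s 1).
      1 / real (ns ! i) ^ (([m + 2] @ replicate s 1) ! i)) has_sum S) (star_indices (0 + 1 + s))"
    using has_sum_reindex_bij_betw[OF bij_betw_star_indices[of 0 s],
      of "\<lambda>ns. \<Prod>i<length ([m + 2] @ replicate s 1). 1 / real (ns ! i) ^ (([m + 2] @ replicate s 1) ! i)"]
    by (simp only: case_prod_unfold)
  then have "zeta_star ([m + 2] @ replicate s 1) = S"
    unfolding zeta_star_def by (intro infsumI) simp
  with S show ?thesis by simp
qed

section \<open>Polylogarithms of ones as real series\<close>

text \<open>The summand of \<open>Li_star\<close> for a composition of ones, as a list product so
  that it splits along blocks of arguments.\<close>

definition li_weight :: "complex list \<Rightarrow> nat list \<Rightarrow> complex" where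
  "li_weight xs ns = prod_list (map2 (\<lambda>x n. x ^ n / of_nat n) xs ns)"

lemma li_weight_Cons [simp]: "li_weight (x # xs) (n # ns) = x ^ n / of_nat n * li_weight xs ns"
  by (simp add: li_weight_def)

lemma li_weight_Nil [simp]: "li_weight [] [] = 1"
  by (simp add: li_weight_def)

lemma li_weight_append:
  "length xs = length ns \<Longrightarrow> li_weight (xs @ xs') (ns @ ns') = li_weight xs ns * li_weight xs' ns'"
  by (simp add: li_weight_def)

lemma li_weight_ones: "length ns = d \<Longrightarrow> li_weight (replicate d 1) ns = of_real (recip_prod ns)"
  by (induction ns arbitrary: d) auto

text \<open>Reduces a polylogarithm to a convergent real series over split indices; only the
  summands remain to be matched.\<close>

lemma Li_star_ones:
  assumes T: "((\<lambda>(n, xs, zs). T n xs zs) has_sum S) (SIGMA n:{1..}. lists_above n j \<times> lists_below n s)"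
    and args: "length args = j + 1 + s"
    and weight: "\<And>n xs zs. xs \<in> lists_above n j \<Longrightarrow> zs \<in> lists_below n s \<Longrightarrow>
      li_weight args (xs @ n # zs) = complex_of_real (T n xs zs)"
  shows "Li_star (replicate (j + 1 + s) 1) args = complex_of_real S"
proof -
  let ?J = "SIGMA n:{1..}. lists_above n j \<times> lists_below n s"
  have "((\<lambda>p. complex_of_real (case p of (n, xs, zs) \<Rightarrow> T n xs zs)) has_sum complex_of_real S) ?J"
    by (rule has_sum_of_real[OF T])
  also have "?this \<longleftrightarrow> ((\<lambda>(n, xs, zs). li_weight args (xs @ n # zs)) has_sum complex_of_real S) ?J"
    using weight by (intro has_sum_cong) auto
  also have "\<dots> \<longleftrightarrow> (li_weight args has_sum complex_of_real S) (star_indices (j + 1 + s))"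
    using has_sum_reindex_bij_betw[OF bij_betw_star_indices[of j s], of "li_weight args"]
    by (simp only: case_prod_unfold)
  finally have "infsum (li_weight args) (star_indices (j + 1 + s)) = complex_of_real S"
    by (rule infsumI)
  moreover have "(\<Prod>i<j + 1 + s. args ! i ^ (ns ! i) / of_nat (ns ! i) ^ (replicate (j + 1 + s) 1 ! i))
      = li_weight args ns" if "ns \<in> star_indices (j + 1 + s)" for ns
    using that args
    by (auto simp: li_weight_def prod.list_conv_set_nth atLeast0LessThan star_indices_def
        simp del: prod.lessThan_Suc replicate.simps intro!: prod.cong)
  ultimately show ?thesis
    unfolding Li_star_def length_replicate by (simp only: cong: infsum_cong)
qed

section \<open>The difference of the two polylogarithms\<close>

text \<open>Treats \<open>r = 1\<close> and \<open>r \<ge> 2\<close> together with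
  \<open>s = r - 1\<close>: only the argument list of the second polylogarithm differs, and
  \<open>weight2\<close> records what both forms share. The marked index is preceded by
  \<open>Suc m\<close> others.\<close>

lemma zeta_star_eq_Li_star_diff:
  fixes y :: real
  assumes y: "0 < y" "y < 1"
    and args2: "length args2 = Suc m + 1 + s"
    and weight2: "\<And>N n xs zs. n \<le> N \<Longrightarrow> length xs = m \<Longrightarrow> length zs = s \<Longrightarrow>
      li_weight args2 ((N # xs) @ n # zs) =
        complex_of_real (y ^ (N - n) * recip_prod (N # xs @ [n]) * (y ^ last (n # zs) * recip_prod zs))"
  shows "complex_of_real (zeta_star ([m + 2] @ replicate s 1)) =
    Li_star (replicate (Suc m + 1 + s) 1)
      ([complex_of_real y] @ replicate m 1 @ [inverse (complex_of_real y)] @ replicate s 1)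
    - Li_star (replicate (Suc m + 1 + s) 1) args2"
proof -
  let ?Z = "zeta_star ([m + 2] @ replicate s 1)"
  let ?J = "SIGMA n:{1..}. lists_above n (Suc m) \<times> lists_below n s"
  let ?a = "\<lambda>n xs. y ^ (hd (xs @ [n]) - n) * recip_prod (xs @ [n])"
  let ?T1 = "\<lambda>(n, xs, zs). ?a n xs * recip_prod zs"
  let ?T2 = "\<lambda>(n, xs, zs). ?a n xs * (y ^ last (n # zs) * recip_prod zs)"
  let ?T = "\<lambda>(n, xs, zs). ?a n xs * ((1 - y ^ last (n # zs)) * recip_prod zs)"
  have T: "(?T has_sum ?Z) ?J"
  proof (rule split_has_sum)
    show "((\<lambda>n. head_sum y (Suc m) n * tail_sum y s n) has_sum ?Z) {1..}"
      using zeta_star_has_sum[of m s] by (intro head_tail_has_sum y) simp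
    show "(?a n has_sum head_sum y (Suc m) n) (lists_above n (Suc m))" if "1 \<le> n" for n
      by (rule head_sum_lists[OF y that])
    show "(\<Sum>zs\<in>lists_below n s. (1 - y ^ last (n # zs)) * recip_prod zs) = tail_sum y s n" for n
      by (rule tail_sum_lists)
    show "0 \<le> ?a n xs" for n xs
      using y by (intro mult_nonneg_nonneg recip_prod_nonneg) auto
    show "0 \<le> (1 - y ^ last (n # zs)) * recip_prod zs" for n zs
      using y by (intro mult_nonneg_nonneg recip_prod_nonneg) (auto intro: power_le_one simp del: last.simps)
  qed
  \<comment> \<open>Each polylogarithm has to converge on its own. As the last index is at least 1,
    \<open>1 - y \<le> 1 - y ^ last (n # zs)\<close>, so \<open>?T / (1 - y)\<close> dominates
    \<open>?T1\<close>.\<close>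
  have "(\<lambda>p. 1 / (1 - y) * ?T p) summable_on ?J"
    using T has_sum_imp_summable by (intro summable_on_cmult_right) blast
  then have "?T1 summable_on ?J"
  proof (rule summable_on_comparison_test)
    fix p assume "p \<in> ?J"
    then obtain n xs zs where p: "p = (n, xs, zs)" and n: "1 \<le> n" and zs: "zs \<in> lists_below n s"
      by auto
    have "last (n # zs) \<in> set (n # zs)" by (rule last_in_set) simp
    then have "1 \<le> last (n # zs)" using n zs by (auto simp: lists_below_def simp del: last.simps)
    then have "y ^ last (n # zs) \<le> y ^ 1" using y by (intro power_decreasing) auto
    then have "1 \<le> 1 / (1 - y) * (1 - y ^ last (n # zs))" using y by (simp add: field_simps del: last.simps)
    moreover have nonneg: "0 \<le> ?T1 p"
      using y by (auto simp: p intro!: mult_nonneg_nonneg recip_prod_nonneg simp del: recip_prod_simps)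
    ultimately have "1 * ?T1 p \<le> 1 / (1 - y) * (1 - y ^ last (n # zs)) * ?T1 p"
      by (intro mult_right_mono)
    then show "?T1 p \<le> 1 / (1 - y) * ?T p" by (simp add: p mult_ac del: last.simps recip_prod_simps)
    show "0 \<le> ?T1 p" by (rule nonneg)
  qed
  then obtain S where S: "(?T1 has_sum S) ?J" by (auto simp: summable_on_def)
  \<comment> \<open>The second series is the first minus \<open>?T\<close>, which yields its
    convergence and its value at once.\<close>
  have "((\<lambda>p. ?T1 p - ?T p) has_sum S - ?Z) ?J" 
    using has_sum_add[OF S has_sum_uminusI[OF T]] by simp
  also have "(\<lambda>p. ?T1 p - ?T p) = ?T2" 
    by (simp add: fun_eq_iff algebra_simps del: last.simps recip_prod_simps)
  finally have T2: "(?T2 has_sum S - ?Z) ?J" .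
  have split: thesis if xs: "xs \<in> lists_above n (Suc m)"
    and "\<And>N xs'. xs = N # xs' \<Longrightarrow> n \<le> N \<Longrightarrow> length xs' = m \<Longrightarrow> thesis" for n xs thesis
    using that by (auto simp: lists_above_def length_Suc_conv)
  have "Li_star (replicate (Suc m + 1 + s) 1)
      ([complex_of_real y] @ replicate m 1 @ [inverse (complex_of_real y)] @ replicate s 1) = complex_of_real S"
  proof (rule Li_star_ones[OF S])
    fix n xs zs assume xs: "xs \<in> lists_above n (Suc m)" and zs: "zs \<in> lists_below n s"
    obtain N xs' where xs': "xs = N # xs'" "n \<le> N" "length xs' = m" using split[OF xs] by blast
    \<comment> \<open>The leading argument \<open>y\<close> and the marked argument
      \<open>inverse y\<close> together give the exponent \<open>N - n\<close>.\<close>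
    have "y ^ (N - n) = y ^ N * inverse y ^ n"
      using xs' y by (simp add: power_diff power_inverse field_simps)
    then show "li_weight ([complex_of_real y] @ replicate m 1 @ [inverse (complex_of_real y)] @ replicate s 1)
        (xs @ n # zs) = complex_of_real (?a n xs * recip_prod zs)"
      using xs' zs by (simp add: li_weight_append li_weight_ones lists_below_def mult_ac)
  qed simp
  moreover have "Li_star (replicate (Suc m + 1 + s) 1) args2 = complex_of_real (S - ?Z)"
  proof (rule Li_star_ones[OF T2 args2])
    fix n xs zs assume xs: "xs \<in> lists_above n (Suc m)" and zs: "zs \<in> lists_below n s"
    obtain N xs' where "xs = N # xs'" "n \<le> N" "length xs' = m" using split[OF xs] by blast
    with weight2[of n N xs' zs] zs
    show "li_weight args2 (xs @ n # zs) = complex_of_real (?a n xs * (y ^ last (n # zs) * recip_prod zs))"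
      by (simp add: lists_below_def del: last.simps)
  qed
  ultimately show ?thesis by simp
qed

theorem theorem1p4:
  fixes m :: nat and y :: real
  assumes "0 < y" and "y < 1"
  shows "(\<forall>r::nat. r \<ge> 2 \<longrightarrow>
            complex_of_real (zeta_star ([m + 2] @ replicate (r - 1) 1)) =
              Li_star (replicate (m + r + 1) 1)
                ([complex_of_real y] @ replicate m 1 @ [inverse (complex_of_real y)]
                   @ replicate (r - 1) 1)
            - Li_star (replicate (m + r + 1) 1)
                ([complex_of_real y] @ replicate m 1 @ [inverse (complex_of_real y)]
                   @ replicate (r - 2) 1 @ [complex_of_real y])) \<and>
         complex_of_real (zeta_star [m + 2]) =
              Li_star (replicate (m + 2) 1)
                ([complex_of_real y] @ replicate m 1 @ [inverse (complex_of_real y)])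
            - Li_star (replicate (m + 2) 1)
                ([complex_of_real y] @ replicate (m + 1) 1)"
proof (intro conjI allI impI)
  have y_diff: "complex_of_real y ^ (N - n) = complex_of_real y ^ N * inverse (complex_of_real y) ^ n"
    if "n \<le> N" for N n
    using that assms by (simp add: power_diff power_inverse field_simps)
  fix r :: nat assume "2 \<le> r"
  then obtain t where r: "r = Suc (Suc t)" by (metis add_2_eq_Suc le_Suc_ex)
  let ?args = "[complex_of_real y] @ replicate m 1 @ [inverse (complex_of_real y)]
     @ replicate t 1 @ [complex_of_real y]"
  have "li_weight ?args ((N # xs) @ n # zs) =
        complex_of_real (y ^ (N - n) * recip_prod (N # xs @ [n]) * (y ^ last (n # zs) * recip_prod zs))"
    if "n \<le> N" "length xs = m" "length zs = Suc t" for N n xs zs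
  proof -
    \<comment> \<open>For \<open>r \<ge> 2\<close> some index follows the marked one, and the final
      argument \<open>y\<close> acts on the last of them.\<close>
    have "zs \<noteq> []" using that by auto
    then obtain ws l where "zs = ws @ [l]" by (metis rev_exhaust)
    with that show ?thesis by (simp add: li_weight_append li_weight_ones y_diff mult_ac)
  qed
  with zeta_star_eq_Li_star_diff[OF assms, of ?args m "Suc t"]
  show "complex_of_real (zeta_star ([m + 2] @ replicate (r - 1) 1)) =
              Li_star (replicate (m + r + 1) 1)
                ([complex_of_real y] @ replicate m 1 @ [inverse (complex_of_real y)]
                   @ replicate (r - 1) 1)
            - Li_star (replicate (m + r + 1) 1)
                ([complex_of_real y] @ replicate m 1 @ [inverse (complex_of_real y)]
                   @ replicate (r - 2) 1 @ [complex_of_real y])"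
    by (simp add: r)
next
  let ?args = "[complex_of_real y] @ replicate (m + 1) 1"
  have "li_weight ?args ((N # xs) @ n # zs) =
        complex_of_real (y ^ (N - n) * recip_prod (N # xs @ [n]) * (y ^ last (n # zs) * recip_prod zs))"
    if "n \<le> N" "length xs = m" "length zs = 0" for N n xs zs
  proof -
    \<comment> \<open>For \<open>r = 1\<close> the marked index is also the last:
      \<open>y ^ n\<close> cancels the inverse power, leaving \<open>y ^ N\<close> and the argument
      1 at that position.\<close>
    have "complex_of_real y ^ N = complex_of_real y ^ (N - n) * complex_of_real y ^ n"
      using that by (simp flip: power_add)
    moreover have "?args = [complex_of_real y] @ replicate m 1 @ [1]"
      by (simp add: replicate_append_same)
    ultimately show ?thesis
      using that by (simp add: li_weight_append li_weight_ones mult_ac del: replicate_Suc)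
  qed
  with zeta_star_eq_Li_star_diff[OF assms, of ?args m 0]
  show "complex_of_real (zeta_star [m + 2]) =
              Li_star (replicate (m + 2) 1)
                ([complex_of_real y] @ replicate m 1 @ [inverse (complex_of_real y)])
            - Li_star (replicate (m + 2) 1)
                ([complex_of_real y] @ replicate (m + 1) 1)"
    by simp
qed

end
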